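(* For every positive integer $n$, $\hat{r}_c(nK_2,C_4)\le \lfloor (9n-1)/2\rfloor$.
   Context: All graphs are finite and simple. $nK_2$ denotes a matching with $n$ edges, and $C_4$ denotes the cycle on 4 vertices. For graphs $G, G_1, G_2$, write $G\to(G_1,G_2)$ if for every colouring of the edges of $G$ with red and blue, $G$ contains either a red copy of $G_1$ (all edges red) or a blue copy of $G_2$ (all edges blue). The connected size Ramsey number $\hat{r}_c(G_1,G_2)$ is the minimum number of edges of a connected graph $G$ with $G\to(G_1,G_2)$. *)

theory Defs
  imports Main "HOL-Library.Extended_Nat"
begin

text \<open>A graph is a pair of a vertex set and a set of edges, an edge being a two-element
  set of vertices.\<close>

type_synonym 'a ugraph = "'a set \<times> 'a set set"

abbreviation vertices :: "'a ugraph \<Rightarrow> 'a set" where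
  "vertices G \<equiv> fst G"

abbreviation edges :: "'a ugraph \<Rightarrow> 'a set set" where
  "edges G \<equiv> snd G"

definition finite_simple_graph :: "'a ugraph \<Rightarrow> bool" where
  "finite_simple_graph G \<longleftrightarrow>
     finite (vertices G) \<and> (\<forall>e \<in> edges G. e \<subseteq> vertices G \<and> card e = 2)"

definition connected_graph :: "'a ugraph \<Rightarrow> bool" where
  "connected_graph G \<longleftrightarrow>
     vertices G \<noteq> {} \<and>
     (\<forall>u \<in> vertices G. \<forall>v \<in> vertices G. (u, v) \<in> {(x, y). {x, y} \<in> edges G}\<^sup>*)"

text \<open>A copy is a subgraph isomorphic to \<open>H\<close>, not necessarily an induced one.\<close>

definition contains_copy :: "'a ugraph \<Rightarrow> 'b ugraph \<Rightarrow> bool" where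
  "contains_copy G H \<longleftrightarrow>
     (\<exists>f. inj_on f (vertices H) \<and> f ` vertices H \<subseteq> vertices G \<and>
          (\<forall>e \<in> edges H. f ` e \<in> edges G))"

datatype colour = Red | Blue

definition colour_class :: "'a ugraph \<Rightarrow> ('a set \<Rightarrow> colour) \<Rightarrow> colour \<Rightarrow> 'a ugraph" where
  "colour_class G c k = (vertices G, {e \<in> edges G. c e = k})"

definition arrows :: "'a ugraph \<Rightarrow> 'b ugraph \<Rightarrow> 'c ugraph \<Rightarrow> bool" where
  "arrows G G1 G2 \<longleftrightarrow>
     (\<forall>c. contains_copy (colour_class G c Red) G1 \<or> contains_copy (colour_class G c Blue) G2)"

text \<open>Every finite graph is isomorphic to one on natural numbers, so it suffices to let
  \<open>G\<close> range over the latter. The values are extended naturals so that the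
  infimum is \<open>\<infinity>\<close>, rather than \<open>0\<close>, if there is no suitable \<open>G\<close>;
  otherwise it is an attained minimum.\<close>

definition connected_size_ramsey :: "'b ugraph \<Rightarrow> 'c ugraph \<Rightarrow> enat" where
  "connected_size_ramsey G1 G2 =
     (INF G \<in> {G :: nat ugraph. finite_simple_graph G \<and> connected_graph G \<and> arrows G G1 G2}.
        enat (card (edges G)))"

definition matching_graph :: "nat \<Rightarrow> nat ugraph" where
  "matching_graph n = ({..<2 * n}, (\<lambda>i. {2 * i, 2 * i + 1}) ` {..<n})"

text \<open>This is the cycle on \<open>k\<close> vertices for \<open>k \<ge> 3\<close>.\<close>

definition cycle_graph :: "nat \<Rightarrow> nat ugraph" where
  "cycle_graph k = ({..<k}, (\<lambda>i. {i, (i + 1) mod k}) ` {..<k})"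

lemma finite_simple_graph_matching_graph: "finite_simple_graph (matching_graph n)"
  by (auto simp: finite_simple_graph_def matching_graph_def)

lemma edges_cycle_graph_4: "edges (cycle_graph 4) = {{0, 1}, {1, 2}, {2, 3}, {3, 0}}"
proof -
  have "{..<4} = {0, 1, 2, 3::nat}" by auto
  moreover have "(0 + 1) mod 4 = (1::nat)" "(1 + 1) mod 4 = (2::nat)"
    "(2 + 1) mod 4 = (3::nat)" "(3 + 1) mod 4 = (0::nat)" by simp_all
  ultimately show ?thesis unfolding cycle_graph_def snd_conv by (simp only: image_insert image_empty)
qed

lemma connected_size_ramsey_attained:
  assumes "connected_size_ramsey G1 G2 \<noteq> \<infinity>"
  obtains G :: "nat ugraph" where "finite_simple_graph G" "connected_graph G" "arrows G G1 G2"
    "connected_size_ramsey G1 G2 = enat (card (edges G))"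
proof -
  let ?A = "{G :: nat ugraph. finite_simple_graph G \<and> connected_graph G \<and> arrows G G1 G2}"
  let ?B = "(\<lambda>G. enat (card (edges G))) ` ?A"
  have "?B \<noteq> {}"
  proof
    assume empty: "?B = {}"
    have "connected_size_ramsey G1 G2 = \<infinity>"
      unfolding connected_size_ramsey_def empty by (simp add: top_enat_def)
    with assms show False by contradiction
  qed
  then obtain x where "x \<in> ?B" unfolding ex_in_conv[symmetric] by (rule exE)
  then have "Inf ?B \<in> ?B" by (rule wellorder_InfI)
  then obtain G where G: "G \<in> ?A" and eq: "Inf ?B = enat (card (edges G))" by (rule imageE)
  show thesis
  proof (rule that)
    show "connected_size_ramsey G1 G2 = enat (card (edges G))"
      unfolding connected_size_ramsey_def by (rule eq)
  qed (use G in blast)+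
qed

end

theory Submission imports Defs begin

text \<open>Joining two disjoint connected graphs by one edge adds up the red matchings that they
  force, so \<open>r(m + n) \<le> r(m) + r(n) + 1\<close>, where \<open>r(n)\<close> denotes the connected size Ramsey number
  of \<open>nK\<^sub>2\<close> against a fixed graph. For \<open>C\<^sub>4\<close> we have \<open>r(1) \<le> 4\<close> by
  \<open>C\<^sub>4\<close> itself, and \<open>r(2) \<le> 8\<close> by \<open>K\<^sub>3\<^sub>,\<^sub>3\<close> minus an edge: it has no triangle, so without a red
  \<open>2K\<^sub>2\<close> the red edges form a star, and deleting any vertex leaves a \<open>C\<^sub>4\<close>.
  Adding \<open>2K\<^sub>2\<close> at a time therefore costs nine edges.\<close>

section \<open>Copies of a graph under enlargement and relabelling of the host\<close>

lemma finite_edges: "finite_simple_graph G \<Longrightarrow> finite (edges G)"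
  unfolding finite_simple_graph_def by (rule finite_subset[of _ "Pow (vertices G)"]) auto

lemma vertices_colour_class [simp]: "vertices (colour_class G c k) = vertices G"
  by (simp add: colour_class_def)

lemma edges_colour_class [simp]: "edges (colour_class G c k) = {e \<in> edges G. c e = k}"
  by (simp add: colour_class_def)

lemma contains_copy_mono:
  assumes "contains_copy G F" "vertices G \<subseteq> vertices G'" "edges G \<subseteq> edges G'"
  shows "contains_copy G' F"
  using assms unfolding contains_copy_def by (meson order_trans subsetD)

text \<open>The embedding of \<open>F\<close> is composed with \<open>s\<close>. This carries copies
  over to a renamed host, in particular to a shifted one.\<close>

lemma contains_copy_relabel:
  assumes "contains_copy G F" and s: "inj_on s (vertices G)"
    and V: "s ` vertices G \<subseteq> vertices G'" and E: "(image s) ` edges G \<subseteq> edges G'"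
  shows "contains_copy G' F"
proof -
  obtain f where f: "inj_on f (vertices F)" "f ` vertices F \<subseteq> vertices G"
    "\<forall>e \<in> edges F. f ` e \<in> edges G"
    using assms(1) unfolding contains_copy_def by blast
  have "inj_on (s \<circ> f) (vertices F)"
    using f s by (meson comp_inj_on inj_on_subset)
  moreover have "(s \<circ> f) ` vertices F \<subseteq> vertices G'"
    using f V by (auto simp: image_comp[symmetric])
  moreover have "\<forall>e \<in> edges F. (s \<circ> f) ` e \<in> edges G'"
    using f(3) E by (simp only: image_comp[symmetric]) blast
  ultimately show ?thesis unfolding contains_copy_def by blast
qed

section \<open>Matchings in vertex-disjoint graphs\<close>

lemma contains_copy_matching_graph_iff:
  "contains_copy G (matching_graph n) \<longleftrightarrow>
     (\<exists>f. inj_on f {..<2 * n} \<and> f ` {..<2 * n} \<subseteq> vertices G \<and>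
          (\<forall>i<n. {f (2 * i), f (2 * i + 1)} \<in> edges G))"
  unfolding contains_copy_def matching_graph_def by (simp add: ball_simps(9) Ball_def[of "{..<n}"])

text \<open>The two embeddings are concatenated. Disjointness of the hosts prevents collisions
  between them, and \<open>K\<close> may have further edges, such as one joining the two
  hosts.\<close>

lemma contains_copy_matching_graph_add:
  assumes G: "contains_copy G (matching_graph m)" and H: "contains_copy H (matching_graph n)"
    and disj: "vertices G \<inter> vertices H = {}"
    and V: "vertices G \<union> vertices H \<subseteq> vertices K" and E: "edges G \<union> edges H \<subseteq> edges K"
  shows "contains_copy K (matching_graph (m + n))"
proof -
  obtain f where f: "inj_on f {..<2 * m}" "f ` {..<2 * m} \<subseteq> vertices G"
    "\<And>i. i < m \<Longrightarrow> {f (2 * i), f (2 * i + 1)} \<in> edges G"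
    using G unfolding contains_copy_matching_graph_iff by blast
  obtain g where g: "inj_on g {..<2 * n}" "g ` {..<2 * n} \<subseteq> vertices H"
    "\<And>i. i < n \<Longrightarrow> {g (2 * i), g (2 * i + 1)} \<in> edges H"
    using H unfolding contains_copy_matching_graph_iff by blast
  \<comment> \<open>The cut \<open>2 * m\<close> is even, so no pair \<open>2 * i\<close>,
    \<open>2 * i + 1\<close> is split between \<open>f\<close> and \<open>g\<close>.\<close>
  define h where "h i = (if i < 2 * m then f i else g (i - 2 * m))" for i
  have hG: "h i \<in> vertices G" if "i < 2 * m" for i
    using that f(2) by (auto simp: h_def)
  have hH: "h i \<in> vertices H" if "\<not> i < 2 * m" "i < 2 * (m + n)" for i
  proof -
    have "i - 2 * m \<in> {..<2 * n}" using that by auto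
    then show ?thesis using that g(2) by (auto simp: h_def)
  qed
  have "inj_on h {..<2 * (m + n)}"
  proof (rule inj_onI)
    fix i j assume ij: "i \<in> {..<2 * (m + n)}" "j \<in> {..<2 * (m + n)}" "h i = h j"
    \<comment> \<open>Indices on different sides of the cut have values in the disjoint sets
      \<open>vertices G\<close> and \<open>vertices H\<close>.\<close>
    then have iff: "i < 2 * m \<longleftrightarrow> j < 2 * m"
      using hG hH disj by (metis disjoint_iff lessThan_iff)
    show "i = j"
    proof (cases "i < 2 * m")
      case True
      then show ?thesis using ij(3) iff inj_onD[OF f(1)] by (simp add: h_def)
    next
      case False
      have "i - 2 * m = j - 2 * m"
        using False ij iff by (intro inj_onD[OF g(1)]) (auto simp: h_def)
      then show ?thesis using False iff by linarith
    qed
  qed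
  moreover have "h ` {..<2 * (m + n)} \<subseteq> vertices K"
    using hG hH V by (auto simp: image_subset_iff)
  moreover have "{h (2 * i), h (2 * i + 1)} \<in> edges K" if "i < m + n" for i
  proof (cases "i < m")
    case True
    then have "2 * i < 2 * m" "2 * i + 1 < 2 * m" by auto
    then show ?thesis using f(3)[OF True] E by (auto simp: h_def)
  next
    case False
    then have "\<not> 2 * i < 2 * m" "\<not> 2 * i + 1 < 2 * m" "i - m < n"
      "2 * i - 2 * m = 2 * (i - m)" "2 * i + 1 - 2 * m = 2 * (i - m) + 1"
      using that by auto
    then show ?thesis using g(3)[of "i - m"] E unfolding h_def by auto
  qed
  ultimately show ?thesis unfolding contains_copy_matching_graph_iff by blast
qed

section \<open>Connectedness, and joining two graphs by an edge\<close>

lemma connected_graphI: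
  assumes "u \<in> vertices G"
    and "\<And>v. v \<in> vertices G \<Longrightarrow> (u, v) \<in> {(x, y). {x, y} \<in> edges G}\<^sup>*"
  shows "connected_graph G"
proof -
  let ?R = "{(x, y). {x, y} \<in> edges G}"
  \<comment> \<open>Edges are unordered, so walks can be reversed; any two vertices are then linked
    through the root \<open>u\<close>.\<close>
  have "sym (?R\<^sup>*)" by (intro sym_rtrancl) (auto simp: sym_def insert_commute)
  then have "(v, w) \<in> ?R\<^sup>*" if "v \<in> vertices G" "w \<in> vertices G" for v w
    using that assms(2) by (meson rtrancl_trans symD)
  then show ?thesis using assms(1) unfolding connected_graph_def by blast
qed

lemma rtrancl_edges_relabel:
  assumes "(v, w) \<in> {(x, y). {x, y} \<in> E}\<^sup>*" "(image s) ` E \<subseteq> E'"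
  shows "(s v, s w) \<in> {(x, y). {x, y} \<in> E'}\<^sup>*"
  using assms(1)
proof induction
  case (step x y)
  then have "s ` {x, y} \<in> E'" using assms(2) by blast
  then show ?case using step.IH by (auto intro: rtrancl_into_rtrancl)
qed simp

text \<open>A blue \<open>F\<close> inside either part is a blue \<open>F\<close> in the joined
  graph. If there is none, both parts yield their red matchings, which share no vertex.\<close>

lemma connected_size_ramsey_matching_add:
  "connected_size_ramsey (matching_graph (m + n)) F \<le>
     connected_size_ramsey (matching_graph m) F + connected_size_ramsey (matching_graph n) F + 1"
proof (cases "connected_size_ramsey (matching_graph m) F = \<infinity> \<or>
    connected_size_ramsey (matching_graph n) F = \<infinity>")
  case True
  then show ?thesis by auto
next
  \<comment> \<open>Both values are finite, hence attained by actual graphs.\<close>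
  case False
  then obtain G H :: "nat ugraph" where
    G: "finite_simple_graph G" "connected_graph G" "arrows G (matching_graph m) F"
      "connected_size_ramsey (matching_graph m) F = enat (card (edges G))" and
    H: "finite_simple_graph H" "connected_graph H" "arrows H (matching_graph n) F"
      "connected_size_ramsey (matching_graph n) F = enat (card (edges H))"
    by (metis connected_size_ramsey_attained)
  \<comment> \<open>Shifting \<open>H\<close> past all vertices of \<open>G\<close> makes the two
    disjoint while staying on natural numbers.\<close>
  obtain N where N: "vertices G \<subseteq> {..<N}"
    using G(1) unfolding finite_simple_graph_def by (meson finite_nat_iff_bounded)
  define s where "s v = v + N" for v
  have inj: "inj s" by (simp add: s_def inj_def)
  have disj: "vertices G \<inter> s ` vertices H = {}" using N by (force simp: s_def)
  obtain u w where u: "u \<in> vertices G" and w: "w \<in> vertices H"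
    using G(2) H(2) unfolding connected_graph_def by blast
  \<comment> \<open>\<open>{u, s w}\<close> is the bridge between \<open>G\<close> and the shifted
    \<open>H\<close>; its ends are arbitrary.\<close>
  define K where
    "K = (vertices G \<union> s ` vertices H, insert {u, s w} (edges G \<union> (image s) ` edges H))"
  have VK: "vertices K = vertices G \<union> s ` vertices H"
    and EK: "edges K = insert {u, s w} (edges G \<union> (image s) ` edges H)"
    by (simp_all add: K_def)
  have "u \<noteq> s w" using u w disj by blast
  moreover have "card (s ` e) = card e" for e using inj by (meson card_image inj_on_subset subset_UNIV)
  ultimately have "finite_simple_graph K"
    using G(1) H(1) u w unfolding finite_simple_graph_def VK EK
    by (simp add: ball_Un image_mono le_supI1 le_supI2)
  moreover have "connected_graph K"
  proof (rule connected_graphI)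
    let ?R = "{(x, y). {x, y} \<in> edges K}"
    show "u \<in> vertices K" using u VK by blast
    fix v assume "v \<in> vertices K"
    then consider "v \<in> vertices G" | v' where "v' \<in> vertices H" "v = s v'" using VK by blast
    then show "(u, v) \<in> ?R\<^sup>*"
    proof cases
      case 1
      then have "(u, v) \<in> {(x, y). {x, y} \<in> edges G}\<^sup>*"
        using G(2) u unfolding connected_graph_def by blast
      \<comment> \<open>With the identity as relabelling, this is just the inclusion of
        \<open>edges G\<close> in \<open>edges K\<close>.\<close>
      then show ?thesis by (rule rtrancl_edges_relabel[where s = "\<lambda>x. x", simplified]) (auto simp: EK)
    next
      case 2
      then have "(w, v') \<in> {(x, y). {x, y} \<in> edges H}\<^sup>*"
        using H(2) w unfolding connected_graph_def by blast
      then have "(s w, v) \<in> ?R\<^sup>*"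
        unfolding 2 by (rule rtrancl_edges_relabel) (auto simp: EK)
      moreover have "(u, s w) \<in> ?R" by (simp add: EK)
      ultimately show ?thesis by (rule converse_rtrancl_into_rtrancl[rotated])
    qed
  qed
  moreover have "arrows K (matching_graph (m + n)) F"
    unfolding arrows_def
  proof (intro allI disjCI)
    fix c assume blue: "\<not> contains_copy (colour_class K c Blue) F"
    \<comment> \<open>The colouring of \<open>K\<close> is pulled back along the shift, giving a
      colouring of \<open>H\<close> itself. Then \<open>?H\<close> is the red part of the shifted
      copy, kept on its own vertex set so that it is disjoint from \<open>G\<close>.\<close>
    let ?c = "\<lambda>e. c (s ` e)"
    let ?H = "(s ` vertices H, (image s) ` edges (colour_class H ?c Red))"
    have "\<not> contains_copy (colour_class G c Blue) F"
      using blue contains_copy_mono[of "colour_class G c Blue" F "colour_class K c Blue"]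
      by (auto simp: VK EK)
    then have red_G: "contains_copy (colour_class G c Red) (matching_graph m)"
      using G(3) unfolding arrows_def by blast
    have "\<not> contains_copy (colour_class H ?c Blue) F"
      using blue inj_on_subset[OF inj subset_UNIV]
        contains_copy_relabel[of "colour_class H ?c Blue" F s "colour_class K c Blue"]
      by (auto simp: VK EK)
    then have "contains_copy (colour_class H ?c Red) (matching_graph n)"
      using H(3) unfolding arrows_def by blast
    then have "contains_copy ?H (matching_graph n)"
      by (rule contains_copy_relabel[OF _ inj_on_subset[OF inj subset_UNIV]]) auto
    with red_G show "contains_copy (colour_class K c Red) (matching_graph (m + n))"
      by (rule contains_copy_matching_graph_add) (use disj in \<open>auto simp: VK EK\<close>)
  qed
  ultimately have "connected_size_ramsey (matching_graph (m + n)) F \<le> enat (card (edges K))"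
    unfolding connected_size_ramsey_def by (intro INF_lower) simp
  also have "card (edges K) \<le> Suc (card (edges G \<union> (image s) ` edges H))"
    unfolding EK by (simp add: card_insert_if finite_edges G(1) H(1))
  also have "\<dots> \<le> card (edges G) + card (edges H) + 1"
    using card_Un_le[of "edges G" "(image s) ` edges H"]
      card_image_le[OF finite_edges[OF H(1)], of "image s"] by linarith
  finally show ?thesis by (simp add: G(4) H(4) one_enat_def)
qed

section \<open>The graphs for one and two matching edges\<close>

lemma contains_copy_cycle_graph_4I:
  assumes "distinct [a, b, c, d]" "{a, b, c, d} \<subseteq> vertices G"
    and "{a, b} \<in> edges G" "{b, c} \<in> edges G" "{c, d} \<in> edges G" "{d, a} \<in> edges G"
  shows "contains_copy G (cycle_graph 4)"
proof -
  let ?f = "\<lambda>i. [a, b, c, d] ! i"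
  have V: "vertices (cycle_graph 4) = {0, 1, 2, 3}" by (auto simp: cycle_graph_def)
  show ?thesis
    unfolding contains_copy_def edges_cycle_graph_4 V
    using assms by (intro exI[of _ ?f]) (auto simp: inj_on_def numeral_eq_Suc)
qed

lemma contains_copy_matching_graph_1I:
  assumes "e \<subseteq> vertices G" "card e = 2" "e \<in> edges G"
  shows "contains_copy G (matching_graph 1)"
proof -
  obtain a b where "e = {a, b}" "a \<noteq> b" using assms(2) by (auto simp: card_2_iff)
  then show ?thesis
    unfolding contains_copy_matching_graph_iff using assms
    by (intro exI[of _ "\<lambda>i. [a, b] ! i"]) (auto simp: inj_on_def less_Suc_eq numeral_eq_Suc)
qed

lemma contains_copy_matching_graph_2I:
  assumes "distinct [a, b, c, d]" "{a, b, c, d} \<subseteq> vertices G" "{a, b} \<in> edges G" "{c, d} \<in> edges G"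
  shows "contains_copy G (matching_graph 2)"
proof -
  \<comment> \<open>Each edge is viewed as a graph on its own two vertices, so that the lemma on
    disjoint hosts applies.\<close>
  have "contains_copy ({a, b}, {{a, b}}) (matching_graph 1)"
    "contains_copy ({c, d}, {{c, d}}) (matching_graph 1)"
    by (rule contains_copy_matching_graph_1I; use assms(1) in simp)+
  then have "contains_copy G (matching_graph (1 + 1))"
    by (rule contains_copy_matching_graph_add) (use assms in auto)
  then show ?thesis by (simp only: one_add_one)
qed

lemma connected_size_ramsey_le:
  fixes G :: "nat ugraph"
  assumes "finite_simple_graph G" "connected_graph G" "arrows G G1 G2" "card (edges G) \<le> k"
  shows "connected_size_ramsey G1 G2 \<le> enat k"
  unfolding connected_size_ramsey_def by (rule INF_lower2[of G]) (use assms in auto)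

text \<open>A single red edge is already a red \<open>matching_graph 1\<close>; with no red edge the
  whole cycle is blue.\<close>

lemma connected_size_ramsey_1_C4: "connected_size_ramsey (matching_graph 1) (cycle_graph 4) \<le> enat 4"
proof (rule connected_size_ramsey_le)
  let ?E = "{{0, 1}, {1, 2}, {2, 3}, {3, 0}} :: nat set set"
  let ?G = "({0, 1, 2, 3}, ?E)"
  show "finite_simple_graph ?G" by (simp add: finite_simple_graph_def)
  show "connected_graph ?G"
  proof (rule connected_graphI[of 0])
    let ?R = "{(x, y). {x, y} \<in> edges ?G}"
    have 1: "(0, 1) \<in> ?R\<^sup>*" and 3: "(0, 3) \<in> ?R\<^sup>*" by (rule r_into_rtrancl, auto)+
    have "(1, 2) \<in> ?R" by auto
    with 1 have 2: "(0, 2) \<in> ?R\<^sup>*" by (rule rtrancl_into_rtrancl)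
    fix v assume "v \<in> vertices ?G"
    then consider "v = 0" | "v = 1" | "v = 2" | "v = 3" by auto
    then show "(0, v) \<in> ?R\<^sup>*" by cases (use 1 2 3 in simp_all)
  qed simp
  show "arrows ?G (matching_graph 1) (cycle_graph 4)"
    unfolding arrows_def
  proof (intro allI disjCI)
    fix c assume "\<not> contains_copy (colour_class ?G c Blue) (cycle_graph 4)"
    then have "\<not> (\<forall>e\<in>?E. c e = Blue)"
      using contains_copy_cycle_graph_4I[of 0 1 2 3 "colour_class ?G c Blue"] by auto
    then obtain e where "e \<in> ?E" "c e = Red" using colour.exhaust by blast
    moreover have "e \<subseteq> vertices ?G" "card e = 2" using \<open>e \<in> ?E\<close> by auto
    ultimately show "contains_copy (colour_class ?G c Red) (matching_graph 1)"
      by (intro contains_copy_matching_graph_1I[of e]) simp_all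
  qed
  show "card (edges ?G) \<le> 4" unfolding snd_conv by (intro card_insert_le_m1) simp_all
qed

lemma connected_size_ramsey_2_C4: "connected_size_ramsey (matching_graph 2) (cycle_graph 4) \<le> enat 8"
proof (rule connected_size_ramsey_le)
  \<comment> \<open>The parts are \<open>{0, 1, 2}\<close> and \<open>{3, 4, 5}\<close>; the missing
    edge is \<open>{0, 3}\<close>.\<close>
  let ?E = "{{0, 4}, {0, 5}, {1, 3}, {1, 4}, {1, 5}, {2, 3}, {2, 4}, {2, 5}} :: nat set set"
  let ?G = "({0, 1, 2, 3, 4, 5}, ?E)"
  show "finite_simple_graph ?G" by (simp add: finite_simple_graph_def)
  show "connected_graph ?G"
  \<comment> \<open>Vertex 1 is adjacent to the whole opposite part; 0 and 2 are reached through
    4.\<close>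
  proof (rule connected_graphI[of 1])
    let ?R = "{(x, y). {x, y} \<in> edges ?G}"
    have 3: "(1, 3) \<in> ?R\<^sup>*" and 4: "(1, 4) \<in> ?R\<^sup>*" and 5: "(1, 5) \<in> ?R\<^sup>*"
      by (rule r_into_rtrancl, simp)+
    have "(4, 0) \<in> ?R" by (simp add: insert_commute)
    with 4 have 0: "(1, 0) \<in> ?R\<^sup>*" by (rule rtrancl_into_rtrancl)
    have "(4, 2) \<in> ?R" by (simp add: insert_commute)
    with 4 have 2: "(1, 2) \<in> ?R\<^sup>*" by (rule rtrancl_into_rtrancl)
    fix v assume "v \<in> vertices ?G"
    then consider "v = 0" | "v = 1" | "v = 2" | "v = 3" | "v = 4" | "v = 5" by auto
    then show "(1, v) \<in> ?R\<^sup>*" by cases (use 0 2 3 4 5 in simp_all)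
  qed simp
  show "arrows ?G (matching_graph 2) (cycle_graph 4)"
    unfolding arrows_def
  proof (intro allI, rule ccontr)
    fix c
    assume none: "\<not> (contains_copy (colour_class ?G c Red) (matching_graph 2) \<or>
      contains_copy (colour_class ?G c Blue) (cycle_graph 4))"
    let ?r = "\<lambda>a b. c {a, b} = Red"
    \<comment> \<open>Writing blue as not red leaves one propositional atom per edge.\<close>
    have blue: "c e = Blue \<longleftrightarrow> c e \<noteq> Red" for e by (cases "c e") auto
    have cycle: "?r a x \<or> ?r b x \<or> ?r b y \<or> ?r a y"
      if "distinct [a, x, b, y]" "{a, x, b, y} \<subseteq> vertices ?G"
        "{a, x} \<in> edges ?G" "{b, x} \<in> edges ?G" "{b, y} \<in> edges ?G" "{a, y} \<in> edges ?G"
      for a b x y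
    proof (rule ccontr)
      assume "\<not> ?thesis"
      with that(3-) have "{a, x} \<in> edges (colour_class ?G c Blue)"
        "{x, b} \<in> edges (colour_class ?G c Blue)" "{b, y} \<in> edges (colour_class ?G c Blue)"
        "{y, a} \<in> edges (colour_class ?G c Blue)"
        by (simp_all only: edges_colour_class mem_Collect_eq blue insert_commute[of x b]
            insert_commute[of y a] de_Morgan_disj simp_thms)
      then have "contains_copy (colour_class ?G c Blue) (cycle_graph 4)"
        by (rule contains_copy_cycle_graph_4I[rotated 2]) (use that(1,2) in simp_all)
      with none show False by (simp only: simp_thms)
    qed
    have matching: "\<not> (?r a x \<and> ?r b y)"
      if "distinct [a, x, b, y]" "{a, x, b, y} \<subseteq> vertices ?G"
        "{a, x} \<in> edges ?G" "{b, y} \<in> edges ?G" for a b x y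
    proof
      assume "?r a x \<and> ?r b y"
      with that(3-) have "{a, x} \<in> edges (colour_class ?G c Red)"
        "{b, y} \<in> edges (colour_class ?G c Red)"
        by (simp_all only: edges_colour_class mem_Collect_eq simp_thms)
      then have "contains_copy (colour_class ?G c Red) (matching_graph 2)"
        by (rule contains_copy_matching_graph_2I[rotated 2]) (use that(1,2) in simp_all)
      with none show False by (simp only: simp_thms)
    qed
    \<comment> \<open>These are all five 4-cycles of the graph: of the nine in the complete
      bipartite graph, four use the edge \<open>{0, 3}\<close>. Each must contain a red
      edge.\<close>
    have "?r 0 4 \<or> ?r 1 4 \<or> ?r 1 5 \<or> ?r 0 5" "?r 0 4 \<or> ?r 2 4 \<or> ?r 2 5 \<or> ?r 0 5"
      "?r 1 3 \<or> ?r 2 3 \<or> ?r 2 4 \<or> ?r 1 4" "?r 1 3 \<or> ?r 2 3 \<or> ?r 2 5 \<or> ?r 1 5"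
      "?r 1 4 \<or> ?r 2 4 \<or> ?r 2 5 \<or> ?r 1 5"
      by (rule cycle; simp)+
    \<comment> \<open>These are all fourteen pairs of disjoint edges; none is entirely red. Pairwise
      meeting red edges form a star, whose centre misses one of the five cycles, so the clauses are
      contradictory.\<close>
    moreover have "\<not> (?r 0 4 \<and> ?r 1 3)" "\<not> (?r 0 4 \<and> ?r 1 5)" "\<not> (?r 0 4 \<and> ?r 2 3)"
      "\<not> (?r 0 4 \<and> ?r 2 5)" "\<not> (?r 0 5 \<and> ?r 1 3)" "\<not> (?r 0 5 \<and> ?r 1 4)"
      "\<not> (?r 0 5 \<and> ?r 2 3)" "\<not> (?r 0 5 \<and> ?r 2 4)" "\<not> (?r 1 3 \<and> ?r 2 4)"
      "\<not> (?r 1 3 \<and> ?r 2 5)" "\<not> (?r 1 4 \<and> ?r 2 3)" "\<not> (?r 1 4 \<and> ?r 2 5)"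
      "\<not> (?r 1 5 \<and> ?r 2 3)" "\<not> (?r 1 5 \<and> ?r 2 4)"
      by (rule matching; simp)+
    ultimately show False by argo
  qed
  show "card (edges ?G) \<le> 8" unfolding snd_conv by (intro card_insert_le_m1) simp_all
qed

section \<open>Induction on \<open>n\<close> in steps of two\<close>

theorem theorem3:
  fixes n :: nat
  assumes "n \<ge> 1"
  shows "connected_size_ramsey (matching_graph n) (cycle_graph 4) \<le> enat ((9 * n - 1) div 2)"
  using assms
proof (induction n rule: less_induct)
  case (less n)
  let ?r = "\<lambda>k. connected_size_ramsey (matching_graph k) (cycle_graph 4)"
  \<comment> \<open>Both parities need a base case, and the bound takes the values 4 and 8
    there.\<close>
  consider "n = 1" | "n = 2" | m where "n = m + 2" "m \<ge> 1" "m < n"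
  proof -
    have "n = 1 \<or> n = 2 \<or> (n = (n - 2) + 2 \<and> n - 2 \<ge> 1 \<and> n - 2 < n)"
      using less.prems by linarith
    then show thesis using that by metis
  qed
  then show ?case
  proof cases
    case 1
    then show ?thesis using connected_size_ramsey_1_C4 by simp
  next
    case 2
    then show ?thesis using connected_size_ramsey_2_C4 by simp
  next
    case (3 m)
    have "?r n \<le> ?r m + ?r 2 + 1"
      unfolding 3(1) by (rule connected_size_ramsey_matching_add)
    also have "\<dots> \<le> enat ((9 * m - 1) div 2) + enat 8 + 1"
      using less.IH[OF 3(3,2)] connected_size_ramsey_2_C4 by (intro add_mono) simp_all
    \<comment> \<open>Increasing \<open>n\<close> by 2 adds 18 to the numerator, so exactly 9 to the
      quotient. Here \<open>m \<ge> 1\<close> matters: at \<open>m = 0\<close> the subtraction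
      truncates and the equation is off by one.\<close>
    also have "\<dots> = enat ((9 * n - 1) div 2)"
      using 3 by (simp add: one_enat_def)
    finally show ?thesis .
  qed
qed

end
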